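(* There exist linear projections $P_1, P_2, P_1', P_2' : \mathbb{R}^4 \to \mathbb{R}^4$ such that all the principal angles between the ranges and nullspaces of $P_1, P_2$ on the one hand and of $P_1', P_2'$ on the other hand are identical, that is, $$\Theta(A_i, A_j) = \Theta(A_i', A_j') \quad\text{for all } i,j \in\{1,2,3,4\},$$ where $(A_1,A_2,A_3,A_4) = (\operatorname{im} P_1, \ker P_1, \operatorname{im} P_2, \ker P_2)$ and $(A_1',A_2',A_3',A_4') = (\operatorname{im} P_1', \ker P_1', \operatorname{im} P_2', \ker P_2')$, but the spectral radii satisfy $\rho(P_1P_2) = 0$ and $\rho(P_1'P_2') = 2$.
   Context: A linear projection is a linear map $P$ with $P^2 = P$ (not necessarily orthogonal). $\rho$ denotes the spectral radius. $\mathbb{R}^4$ carries the standard Euclidean inner product. Principal angles: for subspaces $S_1, S_2$ of a Euclidean space with $q = \min(\dim S_1, \dim S_2)$, the principal angles $\theta_1,\dots,\theta_q \in [0,\pi/2]$ and principal vectors $u_1,\dots,u_q\in S_1$, $v_1,\dots,v_q\in S_2$ are defined inductively for $k = 1,\dots,q$: $(u_k,v_k)$ maximises $|\langle u, v\rangle|$ over all unit vectors $u\in S_1$, $v\in S_2$ with $\langle u,u_i\rangle = \langle v, v_i\rangle = 0$ for $i<k$, and $\theta_k = \arccos |\langle u_k, v_k\rangle|$. Equivalently, $\theta_k = \arccos\sqrt{\lambda_k}$, where $\lambda_1\ge\dots\ge\lambda_q$ are the first $q$ eigenvalues (with multiplicity) of the restriction of $P_{S_2}P_{S_1}$ to $S_2$,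 with $P_{S_i}$ the orthogonal projection onto $S_i$. $\Theta(S_1,S_2)$ denotes the ordered tuple $(\theta_1,\dots,\theta_q)$. *)

theory Defs
  imports "Jordan_Normal_Form.Spectral_Radius" "HOL-Analysis.Analysis"
begin

no_notation Matrix.vec_index (infixl "$" 100)

definition linear_projection :: "('a::real_vector \<Rightarrow> 'a) \<Rightarrow> bool" where
  "linear_projection P \<longleftrightarrow> linear P \<and> P \<circ> P = P"

definition null_space :: "('a::real_vector \<Rightarrow> 'b::real_vector) \<Rightarrow> 'a set" where
  "null_space f = {x. f x = 0}"

definition admissible_pairs ::
    "'a::euclidean_space set \<Rightarrow> 'a set \<Rightarrow> 'a list \<Rightarrow> 'a list \<Rightarrow> ('a \<times> 'a) set" where
  "admissible_pairs S1 S2 us vs =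
     {(u, v). u \<in> S1 \<and> v \<in> S2 \<and> norm u = 1 \<and> norm v = 1 \<and>
        (\<forall>w\<in>set us. u \<bullet> w = 0) \<and> (\<forall>w\<in>set vs. v \<bullet> w = 0)}"

definition principal_vectors ::
    "'a::euclidean_space set \<Rightarrow> 'a set \<Rightarrow> 'a list \<Rightarrow> 'a list \<Rightarrow> bool" where
  "principal_vectors S1 S2 us vs \<longleftrightarrow>
     length us = min (dim S1) (dim S2) \<and> length vs = min (dim S1) (dim S2) \<and>
     (\<forall>k < min (dim S1) (dim S2).
        (us ! k, vs ! k) \<in> admissible_pairs S1 S2 (take k us) (take k vs) \<and>
        (\<forall>(u, v) \<in> admissible_pairs S1 S2 (take k us) (take k vs).
           \<bar>u \<bullet> v\<bar> \<le> \<bar>us ! k \<bullet> vs ! k\<bar>))"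

(* Principal vectors are not unique, but for subspaces they exist and all choices yield the
   same tuple of angles. *)
definition principal_angles ::
    "'a::euclidean_space set \<Rightarrow> 'a set \<Rightarrow> real list" where
  "principal_angles S1 S2 =
     (THE \<theta>. \<exists>us vs. principal_vectors S1 S2 us vs \<and>
                 \<theta> = map2 (\<lambda>u v. arccos \<bar>u \<bullet> v\<bar>) us vs)"

(* On the index type 4, of_nat is a bijection from {0..<4} onto UNIV (with 4 = 0). The entries
   are complex because the spectral radius ranges over all complex eigenvalues. *)
definition complex_mat_of :: "(real^4 \<Rightarrow> real^4) \<Rightarrow> complex Matrix.mat" where
  "complex_mat_of f =
     Matrix.mat 4 4 (\<lambda>(i, j). complex_of_real (f (axis (of_nat j) 1) $ of_nat i))"

definition map_spectral_radius :: "(real^4 \<Rightarrow> real^4) \<Rightarrow> real" where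
  "map_spectral_radius f = spectral_radius (complex_mat_of f)"

end

theory Submission
  imports Defs
begin

text \<open>
  Principal angles record inner products only up to sign, and the signs can be arranged to cancel.
  Take \<open>P\<^sub>2 = P\<^sub>2' = D\<close>, the orthogonal projection of \<open>\<real>\<^sup>4\<close> onto its first two coordinates, and
  for \<open>P\<^sub>1\<close> and \<open>P\<^sub>1'\<close> the rank-one projections \<open>x \<mapsto> (v \<bullet> x) u\<close> and \<open>x \<mapsto> (w \<bullet> x) u\<close> with
  \<open>u = (1, 0, 1, 0)\<close>, \<open>v = (0, 2, 1, 1)\<close>, \<open>w = (2, 0, -1, 1)\<close>. Splitting the inner products with
  \<open>u\<close> along the range and the null space of \<open>D\<close> gives \<open>v \<bullet> u = 0 + 1\<close> and \<open>w \<bullet> u = 2 - 1\<close>. Both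
  totals are 1, so both maps are projections, and the parts in the null space differ only in sign.
  But the only eigenvalue of \<open>x \<mapsto> (v \<bullet> D x) u\<close> that can differ from 0 is the first summand
  \<open>v \<bullet> D u\<close>, which is 0 for \<open>v\<close> and becomes 2 with \<open>w\<close> in place of \<open>v\<close>
  (\<open>map_spectral_radius_rank_one_comp\<close>).

  The two quadruples of subspaces differ only in the null spaces \<open>v\<^sup>\<bottom>\<close> and \<open>w\<^sup>\<bottom>\<close>. No single
  orthogonal map carries one quadruple to the other, as it would conjugate the two products. But
  each pair of subspaces is carried to its counterpart by some orthogonal map, and that preserves
  principal angles (\<open>principal_angles_image\<close>). For the line of \<open>u\<close> and the hyperplane it is the reflection
  exchanging \<open>v\<close> and \<open>w\<close>, which fixes \<open>u\<close>. For the pairs of the hyperplane with the range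
  or the null space of \<open>D\<close> it is a map that preserves those two coordinate planes: swap the first
  two coordinates and negate the third.
\<close>

no_notation scalar_prod (infix "\<bullet>" 70)

section \<open>Principal angles under orthogonal transformations\<close>

lemma orthogonal_transformation_inner:
  "orthogonal_transformation Q \<Longrightarrow> Q x \<bullet> Q y = x \<bullet> y"
  by (simp add: orthogonal_transformation_def)

lemma principal_vectors_image:
  fixes Q :: "'a::euclidean_space \<Rightarrow> 'a"
  assumes Q: "orthogonal_transformation Q" and pv: "principal_vectors S T us vs"
  shows "principal_vectors (Q ` S) (Q ` T) (map Q us) (map Q vs)"
proof -
  have lin: "linear Q" and inj: "inj Q"
    using Q by (simp_all add: orthogonal_transformation_linear orthogonal_transformation_inj)
  have dim: "dim (Q ` X) = dim X" for X
    using lin inj by (metis dim_image_eq inj_on_subset subset_UNIV)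
  have inner: "Q x \<bullet> Q y = x \<bullet> y" for x y
    using Q by (rule orthogonal_transformation_inner)
  have norm: "norm (Q x) = norm x" for x
    using Q by (rule orthogonal_transformation_norm)
  have adm: "admissible_pairs (Q ` S) (Q ` T) (map Q xs) (map Q ys)
      = map_prod Q Q ` admissible_pairs S T xs ys" for xs ys
    by (auto simp: admissible_pairs_def inner norm map_prod_def image_iff)
  show ?thesis
    unfolding principal_vectors_def dim
  proof (intro conjI allI impI)
    show "length (map Q us) = min (dim S) (dim T)" "length (map Q vs) = min (dim S) (dim T)"
      using pv by (simp_all add: principal_vectors_def)
  next
    fix k assume k: "k < min (dim S) (dim T)"
    have len: "k < length us" "k < length vs"
      using pv k by (simp_all add: principal_vectors_def)
    have mem: "(us ! k, vs ! k) \<in> admissible_pairs S T (take k us) (take k vs)"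
      and max: "\<And>u v. (u, v) \<in> admissible_pairs S T (take k us) (take k vs)
                  \<Longrightarrow> \<bar>u \<bullet> v\<bar> \<le> \<bar>us ! k \<bullet> vs ! k\<bar>"
      using pv k unfolding principal_vectors_def by blast+
    show "(map Q us ! k, map Q vs ! k)
        \<in> admissible_pairs (Q ` S) (Q ` T) (take k (map Q us)) (take k (map Q vs))"
      using mem len by (force simp: take_map adm)
    show "\<forall>(u, v) \<in> admissible_pairs (Q ` S) (Q ` T) (take k (map Q us)) (take k (map Q vs)).
        \<bar>u \<bullet> v\<bar> \<le> \<bar>map Q us ! k \<bullet> map Q vs ! k\<bar>"
      using max len by (auto simp: take_map adm inner)
  qed
qed

text \<open>
  The tuples among which the definite description selects are the same for both pairs of
  subspaces, since principal vectors can be carried over by \<open>Q\<close> and back by its inverse.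
\<close>
lemma principal_angles_image:
  fixes Q :: "'a::euclidean_space \<Rightarrow> 'a"
  assumes Q: "orthogonal_transformation Q"
  shows "principal_angles (Q ` S) (Q ` T) = principal_angles S T"
proof -
  define ang where "ang us vs = map2 (\<lambda>u v. arccos \<bar>u \<bullet> v\<bar>) us vs" for us vs :: "'a list"
  define R where "R = inv_into UNIV Q"
  have R: "orthogonal_transformation R"
    using Q unfolding R_def by (rule orthogonal_transformation_inv)
  have RQ: "R ` Q ` X = X" for X
    using orthogonal_transformation_inj[OF Q] by (simp add: R_def image_image)
  have ang: "ang (map F us) (map F vs) = ang us vs"
    if "orthogonal_transformation F" for F and us vs :: "'a list"
    using orthogonal_transformation_inner[OF that]
    by (simp add: ang_def zip_map1 zip_map2 split_def)
  have "(\<exists>us vs. principal_vectors (Q ` S) (Q ` T) us vs \<and> \<theta> = ang us vs) \<longleftrightarrow>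
        (\<exists>us vs. principal_vectors S T us vs \<and> \<theta> = ang us vs)" for \<theta>
    using principal_vectors_image[OF Q, of S T]
      principal_vectors_image[OF R, of "Q ` S" "Q ` T", unfolded RQ] ang[OF Q] ang[OF R]
    by metis
  then show ?thesis
    by (simp add: principal_angles_def ang_def)
qed

lemma orthogonal_transformation_hyperplane:
  fixes Q :: "'a::euclidean_space \<Rightarrow> 'a"
  assumes Q: "orthogonal_transformation Q"
  shows "Q ` {x. v \<bullet> x = 0} = {x. Q v \<bullet> x = 0}"
proof -
  have "\<exists>x. y = Q x" for y
    using orthogonal_transformation_surj[OF Q] by (metis surjD)
  then show ?thesis
    using orthogonal_transformation_inner[OF Q, of v] by (auto simp: image_iff) metis
qed

lemma reflection_exchanging:
  fixes v w :: "'a::euclidean_space"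
  assumes "norm v = norm w"
  obtains Q where "orthogonal_transformation Q" "Q v = w" "\<And>x. x \<bullet> v = x \<bullet> w \<Longrightarrow> Q x = x"
proof (cases "v = w")
  case True
  show ?thesis
    by (rule that[of "\<lambda>x. x"]) (simp_all add: True)
next
  case False
  define n where "n = v - w"
  define Q where "Q x = x - (2 * (x \<bullet> n) / (n \<bullet> n)) *\<^sub>R n" for x
  have n: "n \<bullet> n \<noteq> 0"
    using False by (simp add: n_def)
  have "linear Q"
    unfolding Q_def
    by (rule linearI) (simp_all add: algebra_simps inner_add_left add_divide_distrib)
  moreover have "Q x \<bullet> Q y = x \<bullet> y" for x y
    using n by (simp add: Q_def inner_diff_left inner_diff_right inner_commute field_simps)
  ultimately have orth: "orthogonal_transformation Q"
    by (simp add: orthogonal_transformation_def)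
  \<comment> \<open>Equality of the norms puts the midpoint of v and w into the mirror.\<close>
  have "v \<bullet> v = w \<bullet> w"
    using assms by (simp add: norm_eq)
  then have "2 * (v \<bullet> n) = n \<bullet> n"
    by (simp add: n_def inner_diff_left inner_diff_right inner_commute)
  then have "Q v = w"
    using n by (simp add: Q_def n_def)
  moreover have "Q x = x" if "x \<bullet> v = x \<bullet> w" for x
    using that by (simp add: Q_def n_def inner_diff_right)
  ultimately show ?thesis
    using that orth by blast
qed

section \<open>Spectral radius of a scaled idempotent\<close>

text \<open>
  The equation \<open>A\<^sup>2 = c A\<close> forces every eigenvalue to be a root of \<open>k\<^sup>2 = c k\<close>, and it makes each
  nonzero column of \<open>A\<close> an eigenvector for \<open>c\<close>. The case \<open>c = 0\<close> covers nilpotent matrices.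
\<close>
lemma spectral_radius_scaled_idempotent:
  assumes A: "A \<in> carrier_mat n n" and sq: "A * A = c \<cdot>\<^sub>m A" and nz: "A \<noteq> 0\<^sub>m n n"
  shows "spectral_radius A = norm c"
proof -
  obtain i j where ij: "i < n" "j < n" "A $$ (i, j) \<noteq> 0"
    using A nz by (metis carrier_matD eq_matI index_zero_mat)
  have AA: "A *\<^sub>v (A *\<^sub>v z) = c \<cdot>\<^sub>v (A *\<^sub>v z)" if "z \<in> carrier_vec n" for z
  proof -
    have "A *\<^sub>v (A *\<^sub>v z) = (c \<cdot>\<^sub>m A) *\<^sub>v z"
      using A that by (simp flip: sq)
    then show ?thesis
      using A that by (auto intro!: eq_vecI)
  qed
  have "A *\<^sub>v col A j = c \<cdot>\<^sub>v col A j"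
  proof -
    have "A *\<^sub>v col A j = col (A * A) j"
      using col_mult2[OF A A ij(2)] by (rule sym)
    also have "\<dots> = c \<cdot>\<^sub>v col A j"
      unfolding sq using A ij(2) by simp
    finally show ?thesis .
  qed
  moreover have "col A j \<noteq> 0\<^sub>v n"
  proof
    assume "col A j = 0\<^sub>v n"
    then have "Matrix.vec_index (col A j) i = 0"
      using ij by simp
    then show False
      using A ij by simp
  qed
  ultimately have "eigenvector A (col A j) c"
    using A ij by (simp add: eigenvector_def)
  then have c: "c \<in> spectrum A"
    by (auto simp: spectrum_def eigenvalue_def)
  have le: "norm k \<le> norm c" if k: "k \<in> spectrum A" for k
  proof -
    obtain z where z: "z \<in> carrier_vec n" "z \<noteq> 0\<^sub>v n" "A *\<^sub>v z = k \<cdot>\<^sub>v z"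
      using k A by (auto simp: spectrum_def eigenvalue_def eigenvector_def)
    have eq: "(k * k) \<cdot>\<^sub>v z = (c * k) \<cdot>\<^sub>v z"
      using AA[OF z(1)] A z by (simp add: mult_mat_vec smult_smult_assoc)
    obtain l where l: "l < n" "Matrix.vec_index z l \<noteq> 0"
      using z by (metis carrier_vecD eq_vecI index_zero_vec)
    have "k * k = c * k"
      using arg_cong[OF eq, of "\<lambda>x. Matrix.vec_index x l"] l z(1) by simp
    then show ?thesis
      by auto
  qed
  have "finite (spectrum A)"
    using A by (rule card_finite_spectrum)
  then show ?thesis
    unfolding spectral_radius_def using c le by (intro Max_eqI) auto
qed

lemma linear_component_axis:
  fixes f :: "real^'n \<Rightarrow> real^'m"
  assumes "linear f"
  shows "f x $ i = (\<Sum>k\<in>UNIV. x $ k * f (axis k 1) $ i)"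
proof -
  have "f x = f (\<Sum>k\<in>UNIV. x $ k *\<^sub>R axis k 1)"
    by (metis basis_expansion scalar_mult_eq_scaleR)
  then show ?thesis
    using assms by (simp add: linear_sum linear_scale)
qed

lemma complex_mat_of_compose:
  assumes "linear f"
  shows "complex_mat_of (f \<circ> g) = complex_mat_of f * complex_mat_of g"
proof -
  \<comment> \<open>Matrix indices 0, 1, 2, 3 name the coordinates 4, 1, 2, 3.\<close>
  have sum: "(\<Sum>k = 0..<4. g (of_nat k)) = sum g (UNIV :: 4 set)" for g :: "4 \<Rightarrow> complex"
  proof -
    have "g 0 = g 4"
      by (rule arg_cong[of _ _ g]) simp
    then show ?thesis
      by (simp add: sum_4 eval_nat_numeral)
  qed
  show ?thesis
    by (rule eq_matI)
      (simp_all add: complex_mat_of_def scalar_prod_def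
        linear_component_axis[OF assms, of "g _"] mult.commute
        sum[of "\<lambda>k. complex_of_real (f (axis k 1) $ _ * g (axis _ 1) $ k)", simplified])
qed

lemma map_spectral_radius_scaled_idempotent:
  assumes lin: "linear f" and sq: "\<And>x. f (f x) = c *\<^sub>R f x" and nz: "f x \<noteq> 0"
  shows "map_spectral_radius f = \<bar>c\<bar>"
proof -
  define A where "A = complex_mat_of f"
  have A: "A \<in> carrier_mat 4 4"
    by (simp add: A_def complex_mat_of_def)
  have "A * A = complex_mat_of (f \<circ> f)"
    using lin by (simp add: A_def complex_mat_of_compose)
  also have "\<dots> = complex_of_real c \<cdot>\<^sub>m A"
    by (rule eq_matI) (simp_all add: A_def complex_mat_of_def sq)
  finally have AA: "A * A = complex_of_real c \<cdot>\<^sub>m A" .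
  have "A \<noteq> 0\<^sub>m 4 4"
  proof
    assume zero: "A = 0\<^sub>m 4 4"
    have entry: "f (axis (of_nat j) 1) $ of_nat i = 0" if "i < 4" "j < 4" for i j
      using arg_cong[OF zero, of "\<lambda>B. B $$ (i, j)"] that
      by (simp add: A_def complex_mat_of_def)
    have surj: "\<exists>m<4. of_nat m = k" for k :: 4
    proof -
      have "of_nat 1 = (1::4)" "of_nat 2 = (2::4)" "of_nat 3 = (3::4)" "of_nat 0 = (4::4)"
        by simp_all
      then show ?thesis
        using exhaust_4[of k] by (metis one_less_numeral_iff numeral_less_iff
            semiring_norm(76-81) zero_less_numeral)
    qed
    have "f (axis k 1) $ i = 0" for k i :: 4
      using surj[of k] surj[of i] entry by metis
    then have "f x $ i = 0" for i
      by (subst linear_component_axis[OF lin]) simp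
    then show False
      using nz by (simp add: vec_eq_iff)
  qed
  then show ?thesis
    using spectral_radius_scaled_idempotent[OF A AA]
    by (simp add: map_spectral_radius_def A_def)
qed

text \<open>
  The composite is again of rank one, with \<open>u\<close> spanning its range, so it squares to a multiple of
  itself; the factor is what it multiplies \<open>u\<close> by.
\<close>
lemma map_spectral_radius_rank_one_comp:
  assumes P: "linear P" and "u \<noteq> 0" and "v \<bullet> P x \<noteq> 0"
  shows "map_spectral_radius ((\<lambda>x. (v \<bullet> x) *\<^sub>R u) \<circ> P) = \<bar>v \<bullet> P u\<bar>"
proof (rule map_spectral_radius_scaled_idempotent)
  show "linear ((\<lambda>x. (v \<bullet> x) *\<^sub>R u) \<circ> P)"
    by (rule linearI) (simp_all add: linear_add[OF P] linear_scale[OF P] inner_add_right algebra_simps)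
  show "((\<lambda>x. (v \<bullet> x) *\<^sub>R u) \<circ> P) x \<noteq> 0"
    using assms by simp
qed (simp add: linear_scale[OF P])

section \<open>The two pairs of projections\<close>

lemma rank_one_projection:
  fixes u v :: "'a::real_inner"
  assumes "v \<bullet> u = 1"
  shows "linear_projection (\<lambda>x. (v \<bullet> x) *\<^sub>R u)"
    and "range (\<lambda>x. (v \<bullet> x) *\<^sub>R u) = span {u}"
    and "null_space (\<lambda>x. (v \<bullet> x) *\<^sub>R u) = {x. v \<bullet> x = 0}"
proof -
  have "linear (\<lambda>x. (v \<bullet> x) *\<^sub>R u)"
    by (rule linearI) (simp_all add: inner_add_right algebra_simps)
  then show "linear_projection (\<lambda>x. (v \<bullet> x) *\<^sub>R u)"
    using assms by (simp add: linear_projection_def fun_eq_iff)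
  have "t *\<^sub>R u = (v \<bullet> (t *\<^sub>R u)) *\<^sub>R u" for t
    using assms by simp
  then show "range (\<lambda>x. (v \<bullet> x) *\<^sub>R u) = span {u}"
    unfolding span_singleton by blast
  show "null_space (\<lambda>x. (v \<bullet> x) *\<^sub>R u) = {x. v \<bullet> x = 0}"
    using assms by (auto simp: null_space_def)
qed

theorem mainTheorem1:
  "\<exists>P1 P2 P1' P2' :: real^4 \<Rightarrow> real^4.
     linear_projection P1 \<and> linear_projection P2 \<and>
     linear_projection P1' \<and> linear_projection P2' \<and>
     (let A = [range P1, null_space P1, range P2, null_space P2];
          A' = [range P1', null_space P1', range P2', null_space P2']
      in \<forall>i<4. \<forall>j<4. principal_angles (A ! i) (A ! j) = principal_angles (A' ! i) (A' ! j)) \<and>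
     map_spectral_radius (P1 \<circ> P2) = 0 \<and>
     map_spectral_radius (P1' \<circ> P2') = 2"
proof -
  define u v w :: "real^4" where
    "u = (\<chi> i. if i = 1 \<or> i = 3 then 1 else 0)" and
    "v = (\<chi> i. if i = 1 then 0 else if i = 2 then 2 else 1)" and
    "w = (\<chi> i. if i = 1 then 2 else if i = 2 then 0 else if i = 3 then - 1 else 1)"
  note uvw = u_def v_def w_def
  define P P' D :: "real^4 \<Rightarrow> real^4" where
    "P = (\<lambda>x. (v \<bullet> x) *\<^sub>R u)" and
    "P' = (\<lambda>x. (w \<bullet> x) *\<^sub>R u)" and
    "D = (\<lambda>x. \<chi> i. if i = 1 \<or> i = 2 then x $ i else 0)"
  have "v \<bullet> u = 1" "w \<bullet> u = 1"
    by (simp_all add: uvw inner_vec_def sum_4)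
  note P = rank_one_projection[OF this(1), folded P_def]
    and P' = rank_one_projection[OF this(2), folded P'_def]
  have lin_D: "linear D"
    by (rule linearI) (simp_all add: D_def vec_eq_iff)
  then have D: "linear_projection D"
    by (simp add: linear_projection_def D_def fun_eq_iff vec_eq_iff)
  have range_D: "range D = {x. x $ 3 = 0 \<and> x $ 4 = 0}"
  proof -
    have "D x = x" if "x $ 3 = 0" "x $ 4 = 0" for x
      using that by (simp add: D_def vec_eq_iff forall_4)
    then have "x \<in> range D" if "x $ 3 = 0" "x $ 4 = 0" for x
      using that by (metis rangeI)
    then show ?thesis
      by (auto simp: D_def)
  qed
  have null_D: "null_space D = {x. x $ 1 = 0 \<and> x $ 2 = 0}"
    by (auto simp: null_space_def D_def vec_eq_iff forall_4)

  have "norm v = norm w"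
    by (simp add: norm_eq uvw inner_vec_def sum_4)
  then obtain R where R: "orthogonal_transformation R" "R v = w"
    and fix_R: "\<And>x. x \<bullet> v = x \<bullet> w \<Longrightarrow> R x = x"
    using reflection_exchanging by blast
  have "R u = u"
    using \<open>v \<bullet> u = 1\<close> \<open>w \<bullet> u = 1\<close> by (simp add: fix_R inner_commute)
  then have R1: "R ` range P = range P'"
    using orthogonal_transformation_linear[OF R(1)]
    by (simp add: P P' flip: linear_span_image)
  have R2: "R ` null_space P = null_space P'"
    using orthogonal_transformation_hyperplane[OF R(1), of v] by (simp add: P P' R)

  define S :: "real^4 \<Rightarrow> real^4" where
    "S = (\<lambda>x. \<chi> i. if i = 1 then x $ 2 else if i = 2 then x $ 1
                       else if i = 3 then - x $ 3 else x $ 4)"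
  have "linear S"
    by (rule linearI) (simp_all add: S_def vec_eq_iff)
  then have S: "orthogonal_transformation S"
    by (simp add: orthogonal_transformation_def S_def inner_vec_def sum_4)
  have invol: "S (S x) = x" for x
    by (simp add: S_def vec_eq_iff forall_4)
  have image_S: "S ` X = {x. S x \<in> X}" for X
    using invol by (auto simp: image_iff) (metis invol)
  have "S v = w"
    by (simp add: S_def uvw vec_eq_iff)
  then have S2: "S ` null_space P = null_space P'"
    using orthogonal_transformation_hyperplane[OF S, of v] by (simp add: P P')
  have S3: "S ` range D = range D" and S4: "S ` null_space D = null_space D"
    unfolding image_S range_D null_D by (auto simp: S_def)

  have same: "range P = range P'"
    by (simp add: P P')
  note angles_R = principal_angles_image[OF R(1), symmetric]
  note angles_S = principal_angles_image[OF S, symmetric]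
  have "principal_angles (range P) (null_space P) = principal_angles (range P') (null_space P')"
       "principal_angles (null_space P) (range P) = principal_angles (null_space P') (range P')"
    using angles_R[of "range P" "null_space P"] angles_R[of "null_space P" "range P"]
    by (simp_all only: R1 R2)
  moreover have
    "principal_angles (null_space P) (null_space P) = principal_angles (null_space P') (null_space P')"
    "principal_angles (null_space P) (range D) = principal_angles (null_space P') (range D)"
    "principal_angles (range D) (null_space P) = principal_angles (range D) (null_space P')"
    "principal_angles (null_space P) (null_space D) = principal_angles (null_space P') (null_space D)"
    "principal_angles (null_space D) (null_space P) = principal_angles (null_space D) (null_space P')"
    using angles_S[of "null_space P" "null_space P"]
      angles_S[of "null_space P" "range D"] angles_S[of "range D" "null_space P"]
      angles_S[of "null_space P" "null_space D"] angles_S[of "null_space D" "null_space P"]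
    by (simp_all only: S2 S3 S4)
  ultimately have angles:
    "let A = [range P, null_space P, range D, null_space D];
         A' = [range P', null_space P', range D, null_space D]
     in \<forall>i<4. \<forall>j<4. principal_angles (A ! i) (A ! j) = principal_angles (A' ! i) (A' ! j)"
    by (simp add: same numeral_eq_Suc All_less_Suc)

  have u: "u \<noteq> 0"
    by (simp add: u_def vec_eq_iff forall_4)
  have "v \<bullet> D (axis 2 1) \<noteq> 0" "v \<bullet> D u = 0" "w \<bullet> D u = 2"
    by (simp_all add: uvw D_def axis_def inner_vec_def sum_4)
  then have "map_spectral_radius (P \<circ> D) = 0" "map_spectral_radius (P' \<circ> D) = 2"
    using map_spectral_radius_rank_one_comp[OF lin_D u, of v "axis 2 1"]
      map_spectral_radius_rank_one_comp[OF lin_D u, of w u]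
    by (simp_all add: P_def P'_def)
  then show ?thesis
    using P(1) P'(1) D angles by blast
qed

end
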